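(* Let $\mathcal{R}$ be a commutative ring with unity, let $A$ and $B$ be unital $\mathcal{R}$-algebras, and let $M$ be a unital $(A,B)$-bimodule which is faithful. Assume that the triangular algebra $$\mathcal{T}=\mathrm{Tri}(A;M;B)=\left\{\begin{pmatrix} a & m\\ 0 & b\end{pmatrix} : a\in A,\ m\in M,\ b\in B\right\}$$ is $2$-torsion free. Then every Jordan biderivation $J:\mathcal{T}\times\mathcal{T}\to\mathcal{T}$ is a biderivation.
   Context: $\mathrm{Tri}(A;M;B)$ is an $\mathcal{R}$-algebra under the usual matrix operations. The bimodule $M$ is faithful if it is faithful as a left $A$-module and as a right $B$-module. $\mathcal{T}$ is $2$-torsion free if $2x=0$ implies $x=0$ for $x\in\mathcal{T}$. An $\mathcal{R}$-bilinear map $J:\mathcal{T}\times\mathcal{T}\to\mathcal{T}$ is a Jordan biderivation if for all $x,y,z\in\mathcal{T}$, $J(xy+yx,z)=J(x,z)y+xJ(y,z)+J(y,z)x+yJ(x,z)$ and $J(z,xy+yx)=J(z,x)y+xJ(z,y)+J(z,y)x+yJ(z,x)$; since $\mathcal{T}$ is $2$-torsion free this is equivalent to $J(x^2,y)=xJ(x,y)+J(x,y)x$ and $J(x,y^2)=yJ(x,y)+J(x,y)y$ for all $x,y$. It is a biderivation if $J(xy,z)=J(x,z)y+xJ(y,z)$ and $J(z,xy)=J(z,x)y+xJ(z,y)$ for all $x,y,z\in\mathcal{T}$. *)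

theory Defs
  imports Main
begin

text \<open>
  Unital associative rings are rendered by the sort \<open>{ring, monoid_mult}\<close> and commutative ones
  by \<open>{comm_ring, comm_monoid_mult}\<close>, rather than by \<open>ring_1\<close> and \<open>comm_ring_1\<close>: the latter
  classes contain the axiom \<open>0 \<noteq> 1\<close> and would exclude the zero ring.
\<close>

locale left_unital_module =
  fixes act :: "'s::{ring,monoid_mult} \<Rightarrow> 'm::ab_group_add \<Rightarrow> 'm"
  assumes act_add_right: "act s (x + y) = act s x + act s y"
    and act_add_left: "act (s + t) x = act s x + act t x"
    and act_mult: "act (s * t) x = act s (act t x)"
    and act_one: "act 1 x = x"

locale right_unital_module =
  fixes ract :: "'m::ab_group_add \<Rightarrow> 's::{ring,monoid_mult} \<Rightarrow> 'm"
  assumes ract_add_left: "ract (x + y) s = ract x s + ract y s"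
    and ract_add_right: "ract x (s + t) = ract x s + ract x t"
    and ract_mult: "ract x (s * t) = ract (ract x s) t"
    and ract_one: "ract x 1 = x"

text \<open>
  The multiplication and the unit are explicit parameters because those of a triangular algebra
  depend on the actions on the bimodule and hence cannot come from a type class instance.
\<close>

locale unital_algebra = left_unital_module scale
  for scale :: "'r::{comm_ring,comm_monoid_mult} \<Rightarrow> 'a::ab_group_add \<Rightarrow> 'a" +
  fixes mult :: "'a \<Rightarrow> 'a \<Rightarrow> 'a" and one :: 'a
  assumes mult_add_left: "mult (x + y) z = mult x z + mult y z"
    and mult_add_right: "mult x (y + z) = mult x y + mult x z"
    and mult_assoc: "mult (mult x y) z = mult x (mult y z)"
    and mult_one_left: "mult one x = x"
    and mult_one_right: "mult x one = x"
    and scale_mult_left: "scale r (mult x y) = mult (scale r x) y"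
    and scale_mult_right: "scale r (mult x y) = mult x (scale r y)"

text \<open>
  Bimodules over two algebras are understood over the ground ring: the two actions
  induce the same scalar multiplication on the bimodule.  This is what makes the triangular
  matrices an algebra over the ground ring.
\<close>

locale unital_bimodule =
  A: unital_algebra scaleA "(*)" 1 +
  B: unital_algebra scaleB "(*)" 1 +
  M: left_unital_module scaleM +
  L: left_unital_module lact +
  R: right_unital_module ract
  for scaleA :: "'r::{comm_ring,comm_monoid_mult} \<Rightarrow> 'a::{ring,monoid_mult} \<Rightarrow> 'a"
    and scaleB :: "'r \<Rightarrow> 'b::{ring,monoid_mult} \<Rightarrow> 'b"
    and scaleM :: "'r \<Rightarrow> 'm::ab_group_add \<Rightarrow> 'm"
    and lact :: "'a \<Rightarrow> 'm \<Rightarrow> 'm"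
    and ract :: "'m \<Rightarrow> 'b \<Rightarrow> 'm" +
  assumes lact_ract: "ract (lact a m) b = lact a (ract m b)"
    and scale_lact_left: "scaleM r (lact a m) = lact (scaleA r a) m"
    and scale_lact_right: "scaleM r (lact a m) = lact a (scaleM r m)"
    and scale_ract_left: "scaleM r (ract m b) = ract (scaleM r m) b"
    and scale_ract_right: "scaleM r (ract m b) = ract m (scaleB r b)"

definition faithful_left :: "('a::ab_group_add \<Rightarrow> 'm::ab_group_add \<Rightarrow> 'm) \<Rightarrow> bool" where
  "faithful_left lact \<longleftrightarrow> (\<forall>a. (\<forall>m. lact a m = 0) \<longrightarrow> a = 0)"

definition faithful_right :: "('m::ab_group_add \<Rightarrow> 'b::ab_group_add \<Rightarrow> 'm) \<Rightarrow> bool" where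
  "faithful_right ract \<longleftrightarrow> (\<forall>b. (\<forall>m. ract m b = 0) \<longrightarrow> b = 0)"

text \<open>\<open>Tri a m b\<close> is the upper triangular matrix with rows \<open>(a, m)\<close> and \<open>(0, b)\<close>.\<close>

datatype ('a, 'm, 'b) tri = Tri (e11: 'a) (e12: 'm) (e22: 'b)

instantiation tri :: (ab_group_add, ab_group_add, ab_group_add) ab_group_add
begin

definition zero_tri :: "('a, 'b, 'c) tri" where
  "0 = Tri 0 0 0"

definition plus_tri :: "('a, 'b, 'c) tri \<Rightarrow> ('a, 'b, 'c) tri \<Rightarrow> ('a, 'b, 'c) tri" where
  "x + y = Tri (e11 x + e11 y) (e12 x + e12 y) (e22 x + e22 y)"

definition uminus_tri :: "('a, 'b, 'c) tri \<Rightarrow> ('a, 'b, 'c) tri" where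
  "- x = Tri (- e11 x) (- e12 x) (- e22 x)"

definition minus_tri :: "('a, 'b, 'c) tri \<Rightarrow> ('a, 'b, 'c) tri \<Rightarrow> ('a, 'b, 'c) tri" where
  "x - y = Tri (e11 x - e11 y) (e12 x - e12 y) (e22 x - e22 y)"

instance
  by standard (auto simp: zero_tri_def plus_tri_def uminus_tri_def minus_tri_def algebra_simps)

end

definition tri_one :: "('a::monoid_mult, 'm::ab_group_add, 'b::monoid_mult) tri" where
  "tri_one = Tri 1 0 1"

definition tri_scale ::
  "('r \<Rightarrow> 'a \<Rightarrow> 'a) \<Rightarrow> ('r \<Rightarrow> 'm \<Rightarrow> 'm) \<Rightarrow> ('r \<Rightarrow> 'b \<Rightarrow> 'b) \<Rightarrow> 'r \<Rightarrow> ('a, 'm, 'b) tri \<Rightarrow> ('a, 'm, 'b) tri" where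
  "tri_scale scaleA scaleM scaleB r x =
     Tri (scaleA r (e11 x)) (scaleM r (e12 x)) (scaleB r (e22 x))"

definition tri_mult ::
  "('a::times \<Rightarrow> 'm::plus \<Rightarrow> 'm) \<Rightarrow> ('m \<Rightarrow> 'b::times \<Rightarrow> 'm) \<Rightarrow>
   ('a, 'm, 'b) tri \<Rightarrow> ('a, 'm, 'b) tri \<Rightarrow> ('a, 'm, 'b) tri" where
  "tri_mult lact ract x y =
     Tri (e11 x * e11 y) (lact (e11 x) (e12 y) + ract (e12 x) (e22 y)) (e22 x * e22 y)"

lemma (in left_unital_module) act_zero_right: "act s 0 = 0"
  using act_add_right[of s 0 0] by simp

lemma (in left_unital_module) act_zero_left: "act 0 x = 0"
  using act_add_left[of 0 0 x] by simp

lemma (in right_unital_module) ract_zero_left: "ract 0 s = 0"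
  using ract_add_left[of 0 0 s] by simp

lemma (in right_unital_module) ract_zero_right: "ract x 0 = 0"
  using ract_add_right[of x 0 0] by simp

context unital_bimodule
begin

sublocale T: unital_algebra "tri_scale scaleA scaleM scaleB" "tri_mult lact ract" tri_one
  by unfold_locales
    (simp_all add: tri_scale_def tri_mult_def tri_one_def plus_tri_def
      A.act_add_right A.act_add_left A.act_mult A.act_one
      B.act_add_right B.act_add_left B.act_mult B.act_one
      M.act_add_right M.act_add_left M.act_mult M.act_one
      L.act_add_right L.act_add_left L.act_mult L.act_one L.act_zero_right
      R.ract_add_right R.ract_add_left R.ract_mult R.ract_one R.ract_zero_left
      lact_ract algebra_simps
      A.scale_mult_left[symmetric] A.scale_mult_right[symmetric]
      B.scale_mult_left[symmetric] B.scale_mult_right[symmetric]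
      scale_lact_left[symmetric] scale_lact_right[symmetric]
      scale_ract_left[symmetric] scale_ract_right[symmetric])

end

definition bilinear_map ::
  "('r \<Rightarrow> 't::ab_group_add \<Rightarrow> 't) \<Rightarrow> ('t \<Rightarrow> 't \<Rightarrow> 't) \<Rightarrow> bool" where
  "bilinear_map scale J \<longleftrightarrow>
     (\<forall>x y z. J (x + y) z = J x z + J y z) \<and>
     (\<forall>x y z. J z (x + y) = J z x + J z y) \<and>
     (\<forall>r x z. J (scale r x) z = scale r (J x z)) \<and>
     (\<forall>r x z. J z (scale r x) = scale r (J z x))"

definition jordan_biderivation ::
  "('r \<Rightarrow> 't::ab_group_add \<Rightarrow> 't) \<Rightarrow> ('t \<Rightarrow> 't \<Rightarrow> 't) \<Rightarrow> ('t \<Rightarrow> 't \<Rightarrow> 't) \<Rightarrow> bool" where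
  "jordan_biderivation scale mult J \<longleftrightarrow>
     bilinear_map scale J \<and>
     (\<forall>x y z. J (mult x y + mult y x) z =
        mult (J x z) y + mult x (J y z) + mult (J y z) x + mult y (J x z)) \<and>
     (\<forall>x y z. J z (mult x y + mult y x) =
        mult (J z x) y + mult x (J z y) + mult (J z y) x + mult y (J z x))"

definition biderivation ::
  "('r \<Rightarrow> 't::ab_group_add \<Rightarrow> 't) \<Rightarrow> ('t \<Rightarrow> 't \<Rightarrow> 't) \<Rightarrow> ('t \<Rightarrow> 't \<Rightarrow> 't) \<Rightarrow> bool" where
  "biderivation scale mult J \<longleftrightarrow>
     bilinear_map scale J \<and>
     (\<forall>x y z. J (mult x y) z = mult (J x z) y + mult x (J y z)) \<and>
     (\<forall>x y z. J z (mult x y) = mult (J z x) y + mult x (J z y))"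

end

theory Submission
  imports Defs
begin

text \<open>
  Freezing one argument of a Jordan biderivation leaves a Jordan derivation \<open>D\<close> in the other, so
  it suffices that a Jordan derivation of a triangular algebra is a derivation.  The idempotent
  \<open>p = Tri 1 0 0\<close> governs everything.  As \<open>p\<close> squares to itself, \<open>D p = Tri 0 n 0\<close> for some \<open>n\<close>;
  comparing entries in the Jordan identity for \<open>p\<close> and an element supported on a single entry
  then gives, after cancelling factors of two,
  \<open>D (Tri a m b) = Tri (\<alpha> a) (a n + \<phi> m - n b) (\<beta> b)\<close>
  with maps \<open>\<alpha>\<close>, \<open>\<phi>\<close>, \<open>\<beta>\<close> on the three corners (\<open>D_Tri\<close>).

  The Jordan product of an element of \<open>A\<close> or \<open>B\<close> with an element \<open>m\<close> of the bimodule is an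
  ordinary one-sided product, because the other product vanishes.  On such pairs the Jordan
  identity is therefore already a Leibniz rule: \<open>\<phi> (a m) = \<alpha> a m + a \<phi> m\<close> and
  \<open>\<phi> (m b) = \<phi> m b + m \<beta> b\<close>.  Expanding \<open>\<phi> (a a' m)\<close> in two ways and cancelling \<open>m\<close> by
  faithfulness makes \<open>\<alpha>\<close> a derivation, and symmetrically for \<open>\<beta>\<close>.  With these four rules the
  Leibniz rule for \<open>D\<close> is an entrywise computation; the terms in \<open>n\<close> form an inner derivation.
\<close>

locale jordan_derivation_on_tri =
  unital_bimodule scaleA scaleB scaleM lact ract
  for scaleA :: "'r::{comm_ring,comm_monoid_mult} \<Rightarrow> 'a::{ring,monoid_mult} \<Rightarrow> 'a"
    and scaleB :: "'r \<Rightarrow> 'b::{ring,monoid_mult} \<Rightarrow> 'b"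
    and scaleM :: "'r \<Rightarrow> 'm::ab_group_add \<Rightarrow> 'm"
    and lact :: "'a \<Rightarrow> 'm \<Rightarrow> 'm"
    and ract :: "'m \<Rightarrow> 'b \<Rightarrow> 'm" +
  fixes D :: "('a, 'm, 'b) tri \<Rightarrow> ('a, 'm, 'b) tri"
  assumes faithful_left: "faithful_left lact"
    and faithful_right: "faithful_right ract"
    and two_torsion_free: "\<And>x :: ('a, 'm, 'b) tri. x + x = 0 \<Longrightarrow> x = 0"
    and D_add: "D (x + y) = D x + D y"
    and D_jordan: "D (tri_mult lact ract x y + tri_mult lact ract y x) =
      tri_mult lact ract (D x) y + tri_mult lact ract x (D y) +
      tri_mult lact ract (D y) x + tri_mult lact ract y (D x)"
begin

lemmas entries = tri_mult_def plus_tri_def zero_tri_def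

lemmas module_simps =
  L.act_add_right L.act_add_left L.act_mult L.act_one L.act_zero_left L.act_zero_right
  R.ract_add_left R.ract_add_right R.ract_mult R.ract_one R.ract_zero_left R.ract_zero_right
  lact_ract

lemma lact_diff_right: "lact a (m - m') = lact a m - lact a m'"
  using L.act_add_right[of a "m - m'" m'] by (simp add: eq_diff_eq)

lemma ract_diff_left: "ract (m - m') b = ract m b - ract m' b"
  using R.ract_add_left[of "m - m'" m' b] by (simp add: eq_diff_eq)

lemma two_torsion_free_A: "a + a = 0 \<Longrightarrow> a = 0" for a :: 'a
  using two_torsion_free[of "Tri a 0 0"] by (simp add: entries)

lemma two_torsion_free_B: "b + b = 0 \<Longrightarrow> b = 0" for b :: 'b
  using two_torsion_free[of "Tri 0 0 b"] by (simp add: entries)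

definition n :: 'm where "n = e12 (D (Tri 1 0 0))"
definition \<alpha> :: "'a \<Rightarrow> 'a" where "\<alpha> a = e11 (D (Tri a 0 0))"
definition \<phi> :: "'m \<Rightarrow> 'm" where "\<phi> m = e12 (D (Tri 0 m 0))"
definition \<beta> :: "'b \<Rightarrow> 'b" where "\<beta> b = e22 (D (Tri 0 0 b))"

text \<open>
  Taking \<open>x = y = p\<close> in the Jordan identity makes the diagonal entries \<open>u\<close> of \<open>D p\<close> satisfy
  \<open>2 u = 4 u\<close> in one corner and \<open>2 u = 0\<close> in the other.
\<close>

lemma D_idempotent: "D (Tri 1 0 0) = Tri 0 n 0"
proof -
  obtain u v w where D: "D (Tri 1 0 0) = Tri u v w"
    by (cases "D (Tri 1 0 0)")
  have "D (Tri 1 0 0) + D (Tri 1 0 0) = D (Tri 1 0 0 + Tri 1 0 0)"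
    by (simp only: D_add)
  also have "\<dots> = Tri (u + u + u + u) (v + v) 0"
    using D_jordan[of "Tri 1 0 0" "Tri 1 0 0"]
    by (simp add: D entries module_simps add.assoc)
  finally have "u + u = 0" "w + w = 0"
    by (simp_all add: D entries add.assoc)
  then show ?thesis
    using D two_torsion_free_A[of u] two_torsion_free_B[of w] by (simp add: n_def)
qed

lemma D_A: "D (Tri a 0 0) = Tri (\<alpha> a) (lact a n) 0"
proof -
  obtain u v w where D: "D (Tri a 0 0) = Tri u v w"
    by (cases "D (Tri a 0 0)")
  have "D (Tri a 0 0) + D (Tri a 0 0) = D (Tri a 0 0 + Tri a 0 0)"
    by (simp only: D_add)
  also have "\<dots> = Tri (u + u) (v + lact a n) 0"
    using D_jordan[of "Tri 1 0 0" "Tri a 0 0"]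
    by (simp add: D D_idempotent entries module_simps)
  finally have "v = lact a n" "w + w = 0"
    by (simp_all add: D entries)
  then show ?thesis
    using D two_torsion_free_B[of w] by (simp add: \<alpha>_def)
qed

lemma D_M: "D (Tri 0 m 0) = Tri 0 (\<phi> m) 0"
proof -
  obtain u v w where D: "D (Tri 0 m 0) = Tri u v w"
    by (cases "D (Tri 0 m 0)")
  have "Tri u v w = Tri (u + u) v 0"
    using D_jordan[of "Tri 1 0 0" "Tri 0 m 0"]
    by (simp add: D D_idempotent entries module_simps)
  then show ?thesis
    using D by (simp add: \<phi>_def)
qed

text \<open>Here the Jordan product with \<open>p\<close> vanishes.\<close>

lemma D_B: "D (Tri 0 0 b) = Tri 0 (- ract n b) (\<beta> b)"
proof -
  obtain u v w where D: "D (Tri 0 0 b) = Tri u v w"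
    by (cases "D (Tri 0 0 b)")
  have "D 0 = 0"
    using D_add[of 0 0] by simp
  then have "Tri 0 0 0 = Tri (u + u) (ract n b + v) 0"
    using D_jordan[of "Tri 1 0 0" "Tri 0 0 b"]
    by (simp add: D D_idempotent entries module_simps)
  then have "u + u = 0" "v = - ract n b"
    by (simp_all add: eq_neg_iff_add_eq_0 add.commute)
  then show ?thesis
    using D two_torsion_free_A[of u] by (simp add: \<beta>_def)
qed

lemma D_Tri: "D (Tri a m b) = Tri (\<alpha> a) (lact a n + \<phi> m - ract n b) (\<beta> b)"
proof -
  have "Tri a m b = Tri a 0 0 + Tri 0 m 0 + Tri 0 0 b"
    by (simp add: entries)
  then show ?thesis
    by (simp add: D_add D_A D_M D_B) (simp add: entries)
qed

lemma \<phi>_add: "\<phi> (m + m') = \<phi> m + \<phi> m'"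
  using D_add[of "Tri 0 m 0" "Tri 0 m' 0"] by (simp add: entries D_M)

lemma \<phi>_lact: "\<phi> (lact a m) = lact (\<alpha> a) m + lact a (\<phi> m)"
  using D_jordan[of "Tri a 0 0" "Tri 0 m 0"]
  by (simp add: D_A D_M entries module_simps)

lemma \<phi>_ract: "\<phi> (ract m b) = ract (\<phi> m) b + ract m (\<beta> b)"
  using D_jordan[of "Tri 0 m 0" "Tri 0 0 b"]
  by (simp add: D_B D_M entries module_simps)

lemma lact_cancel:
  assumes "\<And>m. lact a m = lact a' m"
  shows "a = a'"
proof -
  have "lact (a - a') m = 0" for m
    using L.act_add_left[of "a - a'" a' m] assms by simp
  then have "a - a' = 0"
    using faithful_left unfolding faithful_left_def by blast
  then show ?thesis by simp
qed

lemma ract_cancel: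
  assumes "\<And>m. ract m b = ract m b'"
  shows "b = b'"
proof -
  have "ract m (b - b') = 0" for m
    using R.ract_add_right[of m "b - b'" b'] assms by simp
  then have "b - b' = 0"
    using faithful_right unfolding faithful_right_def by blast
  then show ?thesis by simp
qed

lemma \<alpha>_mult: "\<alpha> (a * a') = \<alpha> a * a' + a * \<alpha> a'"
proof (rule lact_cancel)
  fix m
  have "\<phi> (lact (a * a') m) = \<phi> (lact a (lact a' m))"
    by (simp only: L.act_mult)
  then show "lact (\<alpha> (a * a')) m = lact (\<alpha> a * a' + a * \<alpha> a') m"
    by (simp only: \<phi>_lact) (simp add: module_simps add.assoc[symmetric])
qed

lemma \<beta>_mult: "\<beta> (b * b') = \<beta> b * b' + b * \<beta> b'"
proof (rule ract_cancel)
  fix m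
  have "\<phi> (ract m (b * b')) = \<phi> (ract (ract m b) b')"
    by (simp only: R.ract_mult)
  then show "ract m (\<beta> (b * b')) = ract m (\<beta> b * b' + b * \<beta> b')"
    by (simp only: \<phi>_ract) (simp add: module_simps add.assoc)
qed

lemma D_mult:
  "D (tri_mult lact ract x y) = tri_mult lact ract (D x) y + tri_mult lact ract x (D y)"
proof (cases x; cases y)
  fix a m b a' m' b'
  assume "x = Tri a m b" "y = Tri a' m' b'"
  then show ?thesis
    by (simp add: tri_mult_def D_Tri)
      (simp add: entries \<alpha>_mult \<beta>_mult \<phi>_add \<phi>_lact \<phi>_ract module_simps
        lact_diff_right ract_diff_left algebra_simps)
qed

end

theorem corollary2p10:
  fixes scaleA :: "'r::{comm_ring,comm_monoid_mult} \<Rightarrow> 'a::{ring,monoid_mult} \<Rightarrow> 'a"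
    and scaleB :: "'r \<Rightarrow> 'b::{ring,monoid_mult} \<Rightarrow> 'b"
    and scaleM :: "'r \<Rightarrow> 'm::ab_group_add \<Rightarrow> 'm"
    and lact :: "'a \<Rightarrow> 'm \<Rightarrow> 'm"
    and ract :: "'m \<Rightarrow> 'b \<Rightarrow> 'm"
    and J :: "('a, 'm, 'b) tri \<Rightarrow> ('a, 'm, 'b) tri \<Rightarrow> ('a, 'm, 'b) tri"
  assumes "unital_algebra scaleA (*) 1"
    and "unital_algebra scaleB (*) 1"
    and "unital_bimodule scaleA scaleB scaleM lact ract"
    and "faithful_left lact"
    and "faithful_right ract"
    and "\<And>x :: ('a, 'm, 'b) tri. x + x = 0 \<Longrightarrow> x = 0"
    and "jordan_biderivation (tri_scale scaleA scaleM scaleB) (tri_mult lact ract) J"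
  shows "biderivation (tri_scale scaleA scaleM scaleB) (tri_mult lact ract) J"
proof -
  have bilinear: "bilinear_map (tri_scale scaleA scaleM scaleB) J"
    using assms(7) by (simp add: jordan_biderivation_def)
  have left: "jordan_derivation_on_tri scaleA scaleB scaleM lact ract (\<lambda>x. J x z)" for z
  proof (intro jordan_derivation_on_tri.intro jordan_derivation_on_tri_axioms.intro assms(3-5))
    show "x = 0" if "x + x = 0" for x :: "('a, 'm, 'b) tri"
      using that by (rule assms(6))
  qed (use assms(7) in \<open>unfold jordan_biderivation_def bilinear_map_def, blast+\<close>)
  have right: "jordan_derivation_on_tri scaleA scaleB scaleM lact ract (J z)" for z
  proof (intro jordan_derivation_on_tri.intro jordan_derivation_on_tri_axioms.intro assms(3-5))
    show "x = 0" if "x + x = 0" for x :: "('a, 'm, 'b) tri"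
      using that by (rule assms(6))
  qed (use assms(7) in \<open>unfold jordan_biderivation_def bilinear_map_def, blast+\<close>)
  show ?thesis
    unfolding biderivation_def
    by (intro conjI allI bilinear jordan_derivation_on_tri.D_mult[OF left]
        jordan_derivation_on_tri.D_mult[OF right])
qed

end
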